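(* Let $-1 < v_{\min} < 0 < v_{\max} < \infty$ and $X_0>0$, and set $$\alpha_- \doteq \frac{1}{1+v_{\max}}.$$ If $0 \le \alpha < \alpha_-$, then the all-time positivity condition holds; that is, for every admissible path $v \in \mathcal{V}$ we have $X(v,k) > 0$ for all $k \ge 0$.
   Context: An admissible path is a sequence $v=\{v(k)\}_{k=0}^\infty$ of real numbers with $v_{\min} \le v(k) \le v_{\max}$ for all $k \ge 0$; $\mathcal{V}$ denotes the set of all admissible paths. For a feedback gain $\alpha \ge 0$ and $v \in \mathcal{V}$, the state $X(v,k)$ (also written $X(k)$) is defined by $X(v,0)=X(v,1)=X_0>0$ and, for $k \ge 1$, $$X(v,k+1) = X(v,k) + \alpha\,(1+v(k-1))\,v(k)\,X(v,k-1).$$ For a given $\alpha\ge 0$, the all-time positivity condition is said to hold if $X(v,k)>0$ for all $v\in\mathcal{V}$ and all $k \ge 0$. *)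

theory Defs
  imports Complex_Main
begin

definition admissible_paths :: "real \<Rightarrow> real \<Rightarrow> (nat \<Rightarrow> real) set" where
  "admissible_paths vmin vmax = {v. \<forall>k. vmin \<le> v k \<and> v k \<le> vmax}"

fun state :: "real \<Rightarrow> real \<Rightarrow> (nat \<Rightarrow> real) \<Rightarrow> nat \<Rightarrow> real" where
  "state \<alpha> X0 v 0 = X0"
| "state \<alpha> X0 v (Suc 0) = X0"
| "state \<alpha> X0 v (Suc (Suc k)) =
     state \<alpha> X0 v (Suc k) + \<alpha> * (1 + v k) * v (Suc k) * state \<alpha> X0 v k"

lemma state_recurrence:
  assumes "k \<ge> 1"
  shows "state \<alpha> X0 v (k + 1) =
    state \<alpha> X0 v k + \<alpha> * (1 + v (k - 1)) * v k * state \<alpha> X0 v (k - 1)"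
  using assms by (cases k) auto

definition all_time_positivity :: "real \<Rightarrow> real \<Rightarrow> real \<Rightarrow> real \<Rightarrow> bool" where
  "all_time_positivity vmin vmax X0 \<alpha> \<longleftrightarrow>
     (\<forall>v \<in> admissible_paths vmin vmax. \<forall>k. state \<alpha> X0 v k > 0)"

definition alpha_minus :: "real \<Rightarrow> real" where
  "alpha_minus vmax = 1 / (1 + vmax)"

end

theory Submission
  imports Defs
begin

text \<open>
  Positivity of \<open>X(k)\<close> and \<open>X(k-1)\<close> alone does not pass to \<open>X(k+1)\<close>, because \<open>v(k)\<close> may be
  negative.  Since \<open>v(k) > -1\<close>, however, the next state stays positive as soon as it would be
  nonnegative under a total loss \<open>v(k) = -1\<close>, that is, as soon as
  \<open>\<alpha> (1 + v(k-1)) X(k-1) \<le> X(k)\<close>.  The strict form of this inequality turns out to be an invariant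
  of the recurrence.  With the abbreviation \<open>m = \<alpha> (1 + v(k-1)) X(k-1)\<close> the inequality one step later
  asserts positivity of \<open>(1 - \<alpha> (1 + v(k))) X(k) + v(k) m\<close>.  After a gain the first summand is
  positive, because \<open>\<alpha> (1 + v(k)) < 1\<close> for every admissible \<open>v(k)\<close>, and the second is nonnegative.
  After a loss, \<open>0 \<le> m < X(k)\<close> bounds the expression below by
  \<open>(1 - \<alpha> (1 + v(k)) + v(k)) X(k) = (1 - \<alpha>) (1 + v(k)) X(k)\<close>, which is positive because \<open>\<alpha> < 1\<close>.
\<close>

lemma margin_step:
  fixes \<alpha> m w x :: real
  assumes "- 1 < w" and "\<alpha> < 1" and "\<alpha> * (1 + w) < 1"
    and "0 \<le> m" and "m < x"
  shows "\<alpha> * (1 + w) * x < x + w * m"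
proof (cases "0 \<le> w")
  case True
  have "\<alpha> * (1 + w) * x < 1 * x"
    using assms by (intro mult_strict_right_mono) auto
  moreover have "0 \<le> w * m"
    using True assms(4) by simp
  ultimately show ?thesis by simp
next
  case False
  have "0 < (1 - \<alpha>) * (1 + w) * x"
    using assms by simp
  moreover have "w * x < w * m"
    using False assms(5) by (simp add: mult_strict_left_mono_neg)
  ultimately show ?thesis by (simp add: algebra_simps)
qed

text \<open>
  Positivity of the current state is carried along in the induction because it makes the
  quantity \<open>m\<close> of the preceding lemma nonnegative.
\<close>

lemma state_margin:
  fixes \<alpha> X0 :: real and v :: "nat \<Rightarrow> real"
  assumes "X0 > 0" and "0 \<le> \<alpha>" and "\<alpha> < 1"
    and above: "\<And>k. - 1 < v k" and gain: "\<And>k. \<alpha> * (1 + v k) < 1"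
  shows "0 < state \<alpha> X0 v k \<and> \<alpha> * (1 + v k) * state \<alpha> X0 v k < state \<alpha> X0 v (Suc k)"
proof (induction k)
  case 0
  have "\<alpha> * (1 + v 0) * X0 < 1 * X0"
    using gain assms(1) by (intro mult_strict_right_mono)
  then show ?case using assms(1) by simp
next
  case (Suc k)
  define m where "m = \<alpha> * (1 + v k) * state \<alpha> X0 v k"
  have m0: "0 \<le> m"
    unfolding m_def using Suc.IH assms(2) above[of k] by simp
  have m_less: "m < state \<alpha> X0 v (Suc k)"
    using Suc.IH by (simp add: m_def)
  have "\<alpha> * (1 + v (Suc k)) * state \<alpha> X0 v (Suc k) < state \<alpha> X0 v (Suc k) + v (Suc k) * m"
    using above assms(3) gain m0 m_less by (rule margin_step)
  then show ?case
    using m0 m_less by (simp add: m_def mult_ac)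
qed

theorem mainTheorem1:
  fixes vmin vmax X0 \<alpha> :: real
  assumes "- 1 < vmin" and "vmin < 0" and "0 < vmax"
    and "X0 > 0"
    and "0 \<le> \<alpha>" and "\<alpha> < alpha_minus vmax"
  shows "all_time_positivity vmin vmax X0 \<alpha>"
  unfolding all_time_positivity_def
proof (intro ballI allI)
  fix v k
  assume "v \<in> admissible_paths vmin vmax"
  then have v: "vmin \<le> v j" "v j \<le> vmax" for j
    by (auto simp: admissible_paths_def)
  have max: "\<alpha> * (1 + vmax) < 1"
    using assms(3,6) by (simp add: alpha_minus_def field_simps)
  have bound: "\<alpha> * (1 + w) < 1" if "w \<le> vmax" for w
  proof -
    have "\<alpha> * (1 + w) \<le> \<alpha> * (1 + vmax)"
      using assms(5) that by (intro mult_left_mono) auto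
    with max show ?thesis by simp
  qed
  have "\<alpha> < 1"
    using bound[of 0] assms(3) by simp
  moreover have "- 1 < v j" for j
    using v(1)[of j] assms(1) by linarith
  ultimately show "0 < state \<alpha> X0 v k"
    using state_margin[of X0 \<alpha> v k] assms(4,5) bound v(2) by blast
qed

end
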